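(* Let $n\ge 2$. Among all tournaments on $n$ vertices, the Rényi $2$-entropy $H_2$ and the Rényi $3$-entropy $H_3$ are each minimized by the transitive $n$-tournament.
   Context: An $n$-tournament $T$ is a directed graph on $n$ vertices such that for each pair of distinct vertices $x,y$ exactly one of the arcs $x\to y$, $y\to x$ is present (no loops). The normalized Laplacian is $\overline{L}_T=\binom{n}{2}^{-1}(D-A)$, where $A$ is the adjacency matrix ($A(i,j)=1$ if $v_i\to v_j$, else $0$) and $D$ is the diagonal matrix of out-degrees; $\Lambda_T$ is its spectrum (multiset of complex eigenvalues with algebraic multiplicity). For an integer $\alpha\ge 2$, the Rényi $\alpha$-entropy of $T$ is $H_\alpha(T)=\frac{1}{1-\alpha}\log_2\left(\sum_{\lambda\in\Lambda_T}\lambda^\alpha\right)$. Convention: if $\sum_{\lambda\in\Lambda_T}\lambda^\alpha=0$ (for $\alpha\in\{2,3\}$ this occurs only for $\alpha=3$ and $T$ the cyclic $3$-tournament), $H_\alpha(T)=+\infty$. A tournament is transitive if $x\to y$ and $y\to z$ imply $x\to z$ for all vertices $x,y,z$; there is exactly one transitive $n$-tournament up to isomorphism. *)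

theory Defs
  imports
    Complex_Main
    "HOL-Library.Extended_Real"
    "Graph_Theory.Pair_Digraph"
    "Jordan_Normal_Form.Char_Poly"
begin

definition tournament :: "nat \<Rightarrow> 'a pair_pre_digraph \<Rightarrow> bool" where
  "tournament n T \<longleftrightarrow> pair_digraph T \<and> card (pverts T) = n \<and>
     (\<forall>x\<in>pverts T. \<forall>y\<in>pverts T. x \<noteq> y \<longrightarrow> ((x, y) \<in> parcs T \<longleftrightarrow> (y, x) \<notin> parcs T))"

definition transitive_tournament :: "nat \<Rightarrow> 'a pair_pre_digraph \<Rightarrow> bool" where
  "transitive_tournament n T \<longleftrightarrow> tournament n T \<and> trans (parcs T)"

definition vertex_enumeration :: "'a pair_pre_digraph \<Rightarrow> (nat \<Rightarrow> 'a) \<Rightarrow> bool" where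
  "vertex_enumeration T v \<longleftrightarrow> bij_betw v {0..<card (pverts T)} (pverts T)"

definition adjacency_mat :: "'a pair_pre_digraph \<Rightarrow> (nat \<Rightarrow> 'a) \<Rightarrow> complex mat" where
  "adjacency_mat T v = mat (card (pverts T)) (card (pverts T))
     (\<lambda>(i, j). if (v i, v j) \<in> parcs T then 1 else 0)"

definition out_degree_mat :: "'a pair_pre_digraph \<Rightarrow> (nat \<Rightarrow> 'a) \<Rightarrow> complex mat" where
  "out_degree_mat T v = mat (card (pverts T)) (card (pverts T))
     (\<lambda>(i, j). if i = j then of_nat (out_degree (with_proj T) (v i)) else 0)"

definition normalized_laplacian :: "'a pair_pre_digraph \<Rightarrow> (nat \<Rightarrow> 'a) \<Rightarrow> complex mat" where
  "normalized_laplacian T v =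
     inverse (of_nat (card (pverts T) choose 2)) \<cdot>\<^sub>m (out_degree_mat T v - adjacency_mat T v)"

text \<open>The spectrum does not depend on the enumeration of the vertices that is chosen here;
  see \<open>laplacian_spectrum_eq\<close> below.\<close>

definition laplacian_spectrum :: "'a pair_pre_digraph \<Rightarrow> complex multiset" where
  "laplacian_spectrum T =
     proots (char_poly (normalized_laplacian T (SOME v. vertex_enumeration T v)))"

definition spectral_power_sum :: "nat \<Rightarrow> 'a pair_pre_digraph \<Rightarrow> complex" where
  "spectral_power_sum \<alpha> T = (\<Sum>z\<in>#laplacian_spectrum T. z ^ \<alpha>)"

text \<open>The Laplacian is a real matrix, so the power sum is real (\<open>spectral_power_sum_real\<close> below)
  and taking its real part only changes the type.\<close>

definition renyi_entropy :: "nat \<Rightarrow> 'a pair_pre_digraph \<Rightarrow> ereal" where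
  "renyi_entropy \<alpha> T =
     (if spectral_power_sum \<alpha> T = 0 then \<infinity>
      else ereal (1 / (1 - real \<alpha>) * log 2 (Re (spectral_power_sum \<alpha> T))))"

lemma ex_transitive_tournament:
  "transitive_tournament n \<lparr>pverts = {0..<n}, parcs = {(i, j). i < j \<and> j < n}\<rparr>"
proof -
  have "{(i, j). i < j \<and> j < n} \<subseteq> {0..<n} \<times> {0..<n}" by auto
  then have "finite {(i, j). i < j \<and> j < n}" by (rule finite_subset) simp
  then show ?thesis
    unfolding transitive_tournament_def tournament_def
    by (auto simp: trans_def pair_digraph_def pair_fin_digraph_def pair_wf_digraph_def
        pair_fin_digraph_axioms_def pair_loopfree_digraph_def pair_loopfree_digraph_axioms_def)
qed

lemma ex_vertex_enumeration:
  assumes "finite (pverts T)"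
  shows "\<exists>v. vertex_enumeration T v"
  using ex_bij_betw_nat_finite[OF assms] by (simp add: vertex_enumeration_def)

lemma normalized_laplacian_carrier [simp]:
  "normalized_laplacian T v \<in> carrier_mat (card (pverts T)) (card (pverts T))"
  by (rule carrier_matI) (simp_all add: normalized_laplacian_def out_degree_mat_def adjacency_mat_def)

lemma normalized_laplacian_dim [simp]:
  "dim_row (normalized_laplacian T v) = card (pverts T)"
  "dim_col (normalized_laplacian T v) = card (pverts T)"
  by (simp_all add: normalized_laplacian_def out_degree_mat_def adjacency_mat_def)

lemma normalized_laplacian_index:
  assumes "i < card (pverts T)" "j < card (pverts T)"
  shows "normalized_laplacian T v $$ (i, j) =
    inverse (of_nat (card (pverts T) choose 2)) *
      ((if i = j then of_nat (out_degree (with_proj T) (v i)) else 0) -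
       (if (v i, v j) \<in> parcs T then 1 else 0))"
  using assms by (simp add: normalized_laplacian_def out_degree_mat_def adjacency_mat_def)

lemma similar_mat_reindex:
  fixes A :: "complex mat"
  assumes A: "A \<in> carrier_mat n n" and p: "bij_betw p {0..<n} {0..<n}"
  shows "similar_mat (mat n n (\<lambda>(i, j). A $$ (p i, p j))) A"
proof -
  define P :: "complex mat" where "P = mat n n (\<lambda>(i, j). if p i = j then 1 else 0)"
  define Q :: "complex mat" where "Q = mat n n (\<lambda>(i, j). if i = p j then 1 else 0)"
  have inj: "p i = p j \<longleftrightarrow> i = j" if "i < n" "j < n" for i j
    using p that by (auto simp: bij_betw_def inj_on_def)
  have pn: "p i < n" if "i < n" for i
    using p that by (auto simp: bij_betw_def)
  have PQ: "P * Q = 1\<^sub>m n"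
  proof (rule eq_matI)
    fix i j assume "i < dim_row (1\<^sub>m n :: complex mat)" "j < dim_col (1\<^sub>m n :: complex mat)"
    then have ij: "i < n" "j < n" by auto
    have "(P * Q) $$ (i, j) = (\<Sum>k = 0..<n. (if p i = k then 1 else 0) * (if k = p j then 1 else 0))"
      using ij by (simp add: P_def Q_def scalar_prod_def)
    also have "\<dots> = (\<Sum>k = 0..<n. if k = p i then (if p i = p j then 1 else 0) else 0)"
      by (intro sum.cong) auto
    also have "\<dots> = (if i = j then 1 else 0)"
      using ij pn inj by simp
    finally show "(P * Q) $$ (i, j) = 1\<^sub>m n $$ (i, j)"
      using ij by simp
  qed (auto simp: P_def Q_def)
  have PC: "P \<in> carrier_mat n n" and QC: "Q \<in> carrier_mat n n"
    by (auto simp: P_def Q_def)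
  have QP: "Q * P = 1\<^sub>m n"
    by (rule mat_mult_left_right_inverse[OF PC QC PQ])
  have PA: "(P * A) $$ (i, j) = A $$ (p i, j)" if "i < n" "j < n" for i j
  proof -
    have "(P * A) $$ (i, j) = (\<Sum>k = 0..<n. (if p i = k then 1 else 0) * A $$ (k, j))"
      using that A by (simp add: P_def scalar_prod_def)
    also have "\<dots> = (\<Sum>k = 0..<n. if k = p i then A $$ (p i, j) else 0)"
      by (intro sum.cong) auto
    finally show ?thesis using that pn by simp
  qed
  have "mat n n (\<lambda>(i, j). A $$ (p i, p j)) = P * A * Q"
  proof (rule eq_matI)
    fix i j assume "i < dim_row (P * A * Q)" "j < dim_col (P * A * Q)"
    then have ij: "i < n" "j < n" by (auto simp: P_def Q_def)
    have PAc: "P * A \<in> carrier_mat n n" using PC A by simp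
    have "(P * A * Q) $$ (i, j) = (\<Sum>k = 0..<n. (P * A) $$ (i, k) * Q $$ (k, j))"
      using ij carrier_matD[OF PAc] carrier_matD[OF QC]
      by (simp add: scalar_prod_def del: index_mult_mat(2,3))
    also have "\<dots> = (\<Sum>k = 0..<n. if k = p j then A $$ (p i, p j) else 0)"
      using ij by (intro sum.cong) (auto simp: PA Q_def)
    finally show "mat n n (\<lambda>(i, j). A $$ (p i, p j)) $$ (i, j) = (P * A * Q) $$ (i, j)"
      using ij pn by simp
  qed (auto simp: P_def Q_def)
  then show ?thesis
    using A PC QC PQ QP by (intro similar_matI[of _ _ P Q n]) auto
qed

lemma char_poly_normalized_laplacian_unique:
  assumes v: "vertex_enumeration T v" and w: "vertex_enumeration T w"
  shows "char_poly (normalized_laplacian T v) = char_poly (normalized_laplacian T w)"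
proof -
  let ?n = "card (pverts T)"
  define p where "p i = inv_into {0..<?n} w (v i)" for i
  have p: "bij_betw p {0..<?n} {0..<?n}"
    using bij_betw_trans[OF v[unfolded vertex_enumeration_def]
        bij_betw_inv_into[OF w[unfolded vertex_enumeration_def]]]
    by (simp add: p_def comp_def cong: bij_betw_cong)
  have pn: "p i < ?n" if "i < ?n" for i
    using p that by (auto simp: bij_betw_def)
  have inj: "p i = p j \<longleftrightarrow> i = j" if "i < ?n" "j < ?n" for i j
    using p that by (auto simp: bij_betw_def inj_on_def)
  have wp: "w (p i) = v i" if "i < ?n" for i
    unfolding p_def using v w that
    by (intro f_inv_into_f) (auto simp: vertex_enumeration_def bij_betw_def)
  have "normalized_laplacian T v =
      mat ?n ?n (\<lambda>(i, j). normalized_laplacian T w $$ (p i, p j))"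
    by (rule eq_matI) (auto simp: normalized_laplacian_index pn inj wp)
  then show ?thesis
    using char_poly_similar[OF similar_mat_reindex[OF normalized_laplacian_carrier p]] by metis
qed

lemma laplacian_spectrum_eq:
  assumes "vertex_enumeration T v"
  shows "laplacian_spectrum T = proots (char_poly (normalized_laplacian T v))"
  unfolding laplacian_spectrum_def
  using char_poly_normalized_laplacian_unique[OF someI[of "vertex_enumeration T", OF assms] assms]
  by simp

lemma spectral_power_sum_real: "spectral_power_sum \<alpha> T \<in> \<real>"
proof -
  define v where "v = (SOME v. vertex_enumeration T v)"
  define A where "A = normalized_laplacian T v"
  have A: "A \<in> carrier_mat (card (pverts T)) (card (pverts T))"
    by (simp add: A_def)
  interpret cnj: comm_ring_hom cnj by unfold_locales auto
  interpret cnjp: map_poly_comm_ring_hom cnj ..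
  have "map_mat cnj A = A"
    by (rule eq_matI) (auto simp: A_def normalized_laplacian_index)
  then have real: "map_poly cnj (char_poly A) = char_poly A"
    using cnj.char_poly_hom[OF A] by simp
  obtain as where as: "char_poly A = (\<Prod>a\<leftarrow>as. [:- a, 1:])"
    using char_poly_factorized[OF A] by blast
  have roots: "proots (\<Prod>a\<leftarrow>bs. [:- a, 1:]) = mset bs" for bs :: "complex list"
  proof (induction bs)
    case (Cons b bs)
    have "(\<Prod>a\<leftarrow>bs. [:- a, 1:]) \<noteq> 0" by (auto simp: prod_list_zero_iff)
    then have "proots ([:- b, 1:] * (\<Prod>a\<leftarrow>bs. [:- a, 1:])) = {#b#} + mset bs"
      by (subst proots_mult) (simp_all only: Cons.IH proots_linear_factor minus_minus, auto)
    then show ?case by (simp only: list.map prod_list.Cons mset.simps add_mset_add_single[of b "mset bs"] add.commute)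
  qed simp
  have "map_poly cnj (char_poly A) = (\<Prod>a\<leftarrow>map cnj as. [:- a, 1:])"
    by (simp add: as cnjp.hom_prod_list comp_def)
  then have "proots (char_poly A) = mset (map cnj as)"
    by (simp only: real roots)
  moreover have "proots (char_poly A) = mset as"
    by (simp only: as roots)
  ultimately have "image_mset cnj (proots (char_poly A)) = proots (char_poly A)"
    by (metis mset_map)
  then have inv: "image_mset cnj (laplacian_spectrum T) = laplacian_spectrum T"
    by (simp add: laplacian_spectrum_def A_def v_def)
  have "cnj (\<Sum>z\<in>#M. z ^ \<alpha>) = (\<Sum>z\<in>#image_mset cnj M. z ^ \<alpha>)" for M
    by (induction M) auto
  then have "cnj (spectral_power_sum \<alpha> T) = spectral_power_sum \<alpha> T"
    unfolding spectral_power_sum_def by (simp only: inv)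
  then show ?thesis by (simp add: Reals_cnj_iff)
qed

end

theory Submission
  imports Defs "Jordan_Normal_Form.Schur_Decomposition"
begin

text \<open>
  Power sums of eigenvalues are traces of powers. Since \<open>A\<close> has zero diagonal and no \<open>2\<close>-cycles,
  \<open>tr (D - A)\<^sup>2 = \<Sum> d\<^sup>2\<close> and \<open>tr (D - A)\<^sup>3 = \<Sum> d\<^sup>3 - tr A\<^sup>3\<close>, where \<open>d\<close> ranges over the
  scores (out-degrees) and \<open>tr A\<^sup>3\<close> counts the closed walks of length \<open>3\<close>, of which a transitive
  tournament has none. Moreover \<open>\<Sum> (d choose k)\<close> counts the sets of \<open>k + 1\<close> vertices that have
  a source, so it is at most \<open>n choose (k + 1)\<close>, with equality for a transitive tournament.
  As \<open>d\<^sup>2\<close> and \<open>d\<^sup>3\<close> are nonnegative combinations of binomial coefficients \<open>d choose k\<close>, \<open>k \<ge> 1\<close>,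
  the transitive tournament maximises both power sums. Passing to logarithms also needs
  \<open>tr A\<^sup>3 \<le> \<Sum> d\<^sup>3\<close>: indeed \<open>tr A\<^sup>3 \<le> \<Sum> d (n - 1 - d)\<close>, and \<open>d\<^sup>3 - d (n - 1 - d)\<close> is convex
  with nonnegative value at the mean score \<open>(n - 1) / 2\<close> if \<open>n \<ge> 3\<close>.
\<close>

section \<open>Power sums of eigenvalues are traces of powers\<close>

definition mat_trace :: "'a :: comm_monoid_add mat \<Rightarrow> 'a" where
  "mat_trace A = (\<Sum>i = 0..<dim_row A. A $$ (i, i))"

lemma mat_trace_comm:
  fixes A B :: "'a :: comm_semiring_0 mat"
  assumes "A \<in> carrier_mat n m" "B \<in> carrier_mat m n"
  shows "mat_trace (A * B) = mat_trace (B * A)"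
proof -
  have "mat_trace (A * B) = (\<Sum>i = 0..<n. \<Sum>k = 0..<m. A $$ (i, k) * B $$ (k, i))"
    using assms by (simp add: mat_trace_def scalar_prod_def)
  also have "\<dots> = (\<Sum>k = 0..<m. \<Sum>i = 0..<n. A $$ (i, k) * B $$ (k, i))"
    by (rule sum.swap)
  also have "\<dots> = mat_trace (B * A)"
    using assms by (simp add: mat_trace_def scalar_prod_def mult.commute)
  finally show ?thesis .
qed

lemma mat_trace_similar:
  fixes A B :: "'a :: comm_semiring_1 mat"
  assumes "similar_mat_wit A B P Q"
  shows "mat_trace A = mat_trace B"
proof -
  define n where "n = dim_row A"
  note D = similar_mat_witD[OF n_def assms]
  have "mat_trace A = mat_trace (P * B * Q)"
    by (rule arg_cong[OF D(3)])
  also have "\<dots> = mat_trace (Q * (P * B))"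
    using D(5-7) by (intro mat_trace_comm[of _ n n]) auto
  also have "Q * (P * B) = B"
    using assoc_mult_mat[OF D(7,6,5)] D(2) D(5) by simp
  finally show ?thesis .
qed

text \<open>Both claims go through one induction, because the diagonal of the next power depends on
  the triangularity of the previous one: at \<open>(i, i)\<close> the left factor kills the terms
  \<open>l < i\<close> and the right factor the terms \<open>l > i\<close>.\<close>

lemma upper_triangular_pow:
  fixes B :: "'a :: comm_semiring_1 mat"
  assumes B: "B \<in> carrier_mat n n" and ut: "upper_triangular B"
  shows "upper_triangular (B ^\<^sub>m k) \<and> (\<forall>i<n. (B ^\<^sub>m k) $$ (i, i) = B $$ (i, i) ^ k)"
proof (induction k)
  case 0
  show ?case using B by auto
next
  case (Suc k)
  have 0: "(B ^\<^sub>m k) $$ (i, j) = 0" "B $$ (i, j) = 0" if "j < i" "i < n" for i j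
    using Suc ut B that by (auto simp: upper_triangular_def)
  have prod: "(B ^\<^sub>m Suc k) $$ (i, j) = (\<Sum>l = 0..<n. (B ^\<^sub>m k) $$ (i, l) * B $$ (l, j))"
    if "i < n" "j < n" for i j
    using B that by (simp add: scalar_prod_def)
  have "upper_triangular (B ^\<^sub>m Suc k)"
  proof (rule upper_triangularI)
    fix i j assume ij: "j < i" "i < dim_row (B ^\<^sub>m Suc k)"
    then have "(B ^\<^sub>m k) $$ (i, l) * B $$ (l, j) = 0" if "l < n" for l
      using that B 0[of l i] 0[of j l] by (cases "l < i") auto
    then show "(B ^\<^sub>m Suc k) $$ (i, j) = 0"
      using ij B by (subst prod) auto
  qed
  moreover have "(B ^\<^sub>m Suc k) $$ (i, i) = B $$ (i, i) ^ Suc k" if i: "i < n" for i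
  proof -
    have "(B ^\<^sub>m k) $$ (i, l) * B $$ (l, i) = (if l = i then B $$ (i, i) ^ Suc k else 0)"
      if "l < n" for l
      using that i 0[of l i] 0[of i l] Suc by (cases l i rule: linorder_cases) (auto simp: mult.commute)
    then show ?thesis
      using i by (simp add: prod del: pow_mat.simps)
  qed
  ultimately show ?case by blast
qed

lemma proots_prod_list_linear:
  "proots (\<Prod>a\<leftarrow>as. [:- a, 1:]) = mset (as :: 'a :: idom list)"
proof (induction as)
  case (Cons b as)
  have "(\<Prod>a\<leftarrow>as. [:- a, 1:]) \<noteq> 0" by (auto simp: prod_list_zero_iff)
  then have "proots ([:- b, 1:] * (\<Prod>a\<leftarrow>as. [:- a, 1:])) = {#b#} + mset as"
    by (subst proots_mult) (simp_all only: Cons.IH proots_linear_factor minus_minus, auto)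
  then show ?case
    by (simp only: list.map prod_list.Cons mset.simps add_mset_add_single[of b "mset as"] add.commute)
qed simp

text \<open>Over the complex numbers the characteristic polynomial splits, and Schur decomposition
  gives a similar triangular matrix with the eigenvalues on its diagonal. Powers preserve the
  similarity, and the trace is invariant under it.\<close>

lemma sum_proots_char_poly_pow:
  fixes A :: "complex mat"
  assumes A: "A \<in> carrier_mat n n"
  shows "(\<Sum>z\<in>#proots (char_poly A). z ^ k) = mat_trace (A ^\<^sub>m k)"
proof -
  obtain as where as: "char_poly A = (\<Prod>a\<leftarrow>as. [:- a, 1:])"
    using char_poly_factorized[OF A] by blast
  obtain B P Q where BPQ: "schur_decomposition A as = (B, P, Q)"
    by (cases "schur_decomposition A as") auto
  have wit: "similar_mat_wit A B P Q" and ut: "upper_triangular B" and diag: "diag_mat B = as"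
    using schur_decomposition[OF A as BPQ] by auto
  have B: "B \<in> carrier_mat n n"
    using similar_mat_witD2[OF A wit] by auto
  have "(\<Sum>z\<in>#proots (char_poly A). z ^ k) = (\<Sum>z\<leftarrow>as. z ^ k)"
    by (simp add: as proots_prod_list_linear flip: sum_mset_sum_list)
  also have "\<dots> = (\<Sum>i = 0..<n. B $$ (i, i) ^ k)"
    using B by (simp add: diag_mat_def comp_def sum_list_sum_nth flip: diag)
  also have "\<dots> = mat_trace (B ^\<^sub>m k)"
    using B upper_triangular_pow[OF B ut] by (simp add: mat_trace_def)
  also have "\<dots> = mat_trace (A ^\<^sub>m k)"
    using mat_trace_similar[OF similar_mat_wit_pow[OF wit]] by simp
  finally show ?thesis .
qed

lemma mat_trace_pow_2:
  fixes A :: "'a :: comm_semiring_1 mat"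
  assumes "A \<in> carrier_mat n n"
  shows "mat_trace (A ^\<^sub>m 2) = (\<Sum>i = 0..<n. \<Sum>j = 0..<n. A $$ (i, j) * A $$ (j, i))"
  using assms by (simp add: mat_trace_def numeral_2_eq_2 scalar_prod_def)

lemma mat_trace_pow_3:
  fixes A :: "'a :: comm_semiring_1 mat"
  assumes "A \<in> carrier_mat n n"
  shows "mat_trace (A ^\<^sub>m 3) =
    (\<Sum>i = 0..<n. \<Sum>j = 0..<n. \<Sum>k = 0..<n. A $$ (i, j) * A $$ (j, k) * A $$ (k, i))"
proof -
  have "mat_trace (A ^\<^sub>m 3) =
    (\<Sum>i = 0..<n. \<Sum>k = 0..<n. \<Sum>j = 0..<n. A $$ (i, j) * A $$ (j, k) * A $$ (k, i))"
    using assms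
    by (simp add: mat_trace_def numeral_3_eq_3 scalar_prod_def sum_distrib_right
        del: assoc_mult_mat)
  also have "\<dots> =
    (\<Sum>i = 0..<n. \<Sum>j = 0..<n. \<Sum>k = 0..<n. A $$ (i, j) * A $$ (j, k) * A $$ (k, i))"
    by (intro sum.cong sum.swap refl)
  finally show ?thesis .
qed

section \<open>Score sequences of tournaments\<close>

text \<open>The coefficients here and in \<open>cube_eq_binomials\<close> count surjections onto a
  \<open>k\<close>-set. They are nonnegative, so bounds on the binomial sums can be added
  up.\<close>

lemma square_eq_binomials: "(d :: nat) ^ 2 = 2 * (d choose 2) + (d choose 1)"
  by (induction d) (auto simp: numeral_eq_Suc algebra_simps)

lemma cube_eq_binomials: "(d :: nat) ^ 3 = 6 * (d choose 3) + 6 * (d choose 2) + (d choose 1)"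
proof (induction d)
  case (Suc d)
  have "Suc d ^ 3 = d ^ 3 + 3 * d ^ 2 + 3 * d + 1"
    by (simp add: power3_eq_cube power2_eq_square algebra_simps)
  moreover have "Suc d choose 3 = (d choose 3) + (d choose 2)"
    "Suc d choose 2 = (d choose 2) + d"
    by (simp_all add: eval_nat_numeral)
  ultimately show ?case
    using Suc square_eq_binomials[of d] by simp
qed simp

locale tournament_arcs =
  fixes V :: "'a set" and E :: "('a \<times> 'a) set"
  assumes finite_V: "finite V"
    and E_subset: "E \<subseteq> V \<times> V"
    and irrefl_E: "(x, x) \<notin> E"
    and arc_iff: "x \<in> V \<Longrightarrow> y \<in> V \<Longrightarrow> x \<noteq> y \<Longrightarrow> (x, y) \<in> E \<longleftrightarrow> (y, x) \<notin> E"
begin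

definition score :: "'a \<Rightarrow> nat" where
  "score x = card (E `` {x})"

text \<open>This is tr A^3. The triples are ordered, so each directed triangle counts three
  times.\<close>

definition cyclic_triples :: nat where
  "cyclic_triples =
    (\<Sum>x\<in>V. \<Sum>y\<in>V. \<Sum>z\<in>V. of_bool ((x, y) \<in> E) * of_bool ((y, z) \<in> E) * of_bool ((z, x) \<in> E))"

lemma out_subset: "E `` {x} \<subseteq> V"
  using E_subset by auto

lemma asym_E: "(x, y) \<in> E \<Longrightarrow> (y, x) \<notin> E"
  using E_subset arc_iff irrefl_E by (cases "x = y") auto

lemma score_eq_sum: "score x = (\<Sum>y\<in>V. of_bool ((x, y) \<in> E))"
proof -
  have "V \<inter> {y. (x, y) \<in> E} = E `` {x}" using out_subset by auto
  then show ?thesis using finite_V by (simp add: score_def)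
qed

lemma in_degree_plus_score:
  assumes "y \<in> V"
  shows "(\<Sum>x\<in>V. of_bool ((x, y) \<in> E)) + score y = card V - 1"
proof -
  have "(\<Sum>x\<in>V. of_bool ((x, y) \<in> E)) + score y =
      (\<Sum>x\<in>V. of_bool ((x, y) \<in> E) + of_bool ((y, x) \<in> E))"
    by (simp add: score_eq_sum sum.distrib)
  also have "\<dots> = (\<Sum>x\<in>V. of_bool (x \<noteq> y))"
  proof (intro sum.cong refl)
    fix x assume "x \<in> V"
    then show "of_bool ((x, y) \<in> E) + of_bool ((y, x) \<in> E) = (of_bool (x \<noteq> y) :: nat)"
      using assms arc_iff[of x y] irrefl_E by (cases "x = y") (auto simp: of_bool_def)
  qed
  also have "\<dots> = card (V - {y})"
    using finite_V by (simp add: set_diff_eq Int_def)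
  finally show ?thesis
    using assms finite_V by simp
qed

text \<open>In-degrees and out-degrees have the same sum, and at each vertex they add up to
  \<open>card V - 1\<close>.\<close>

lemma sum_score: "2 * (\<Sum>x\<in>V. score x) = card V * (card V - 1)"
proof -
  have "(\<Sum>x\<in>V. score x) = (\<Sum>y\<in>V. \<Sum>x\<in>V. of_bool ((x, y) \<in> E))"
    unfolding score_eq_sum by (rule sum.swap)
  then have "2 * (\<Sum>x\<in>V. score x) = (\<Sum>y\<in>V. (\<Sum>x\<in>V. of_bool ((x, y) \<in> E)) + score y)"
    by (simp add: sum.distrib)
  then show ?thesis
    by (simp add: in_degree_plus_score)
qed

text \<open>The sum counts the \<open>k + 1\<close>-subsets of \<open>V\<close> that have a source,
  split into the source and the rest.\<close>

lemma sum_score_choose: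
  "(\<Sum>x\<in>V. score x choose k) =
    card ((\<lambda>(x, S). insert x S) ` (SIGMA x:V. {S. S \<subseteq> E `` {x} \<and> card S = k}))"
proof -
  have fin: "finite (E `` {x})" for x
    using finite_subset[OF out_subset finite_V] .
  have inj: "inj_on (\<lambda>(x, S). insert x S) (SIGMA x:V. {S. S \<subseteq> E `` {x} \<and> card S = k})"
  proof (rule inj_onI, clarsimp)
    fix x S y S'
    assume S: "S \<subseteq> E `` {x}" "S' \<subseteq> E `` {y}" and eq: "insert x S = insert y S'"
    \<comment> \<open>The source is unique: two different sources of one set would each beat the
      other.\<close>
    have "x = y"
    proof (rule ccontr)
      assume "x \<noteq> y"
      then have "y \<in> S" "x \<in> S'" using eq by auto
      then show False using S asym_E by blast
    qed
    moreover have "x \<notin> S" "y \<notin> S'" using S irrefl_E by auto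
    ultimately show "x = y \<and> S = S'" using eq by auto
  qed
  show ?thesis
    unfolding card_image[OF inj] using fin finite_V
    by (simp add: score_def n_subsets)
qed

lemma sourced_subsets:
  "(\<lambda>(x, S). insert x S) ` (SIGMA x:V. {S. S \<subseteq> E `` {x} \<and> card S = k})
    \<subseteq> {S. S \<subseteq> V \<and> card S = Suc k}"
proof clarsimp
  fix x S assume S: "x \<in> V" "S \<subseteq> E `` {x}"
  then have "finite S" "x \<notin> S" "S \<subseteq> V"
    using finite_V out_subset irrefl_E by (auto intro: finite_subset)
  then show "S \<subseteq> V \<and> card (insert x S) = Suc (card S)" by simp
qed

lemma sum_score_choose_le: "(\<Sum>x\<in>V. score x choose k) \<le> card V choose Suc k"
  unfolding sum_score_choose using card_mono[OF _ sourced_subsets] finite_V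
  by (simp add: n_subsets)

text \<open>Under a transitive \<open>E\<close> every nonempty set of vertices has a least element,
  which is its source, so the inclusion \<open>sourced_subsets\<close> becomes an equality.\<close>

lemma sum_score_choose_trans:
  assumes "trans E"
  shows "(\<Sum>x\<in>V. score x choose k) = card V choose Suc k"
proof -
  have "{S. S \<subseteq> V \<and> card S = Suc k} \<subseteq>
    (\<lambda>(x, S). insert x S) ` (SIGMA x:V. {S. S \<subseteq> E `` {x} \<and> card S = k})"
  proof clarify
    fix S assume S: "S \<subseteq> V" "card S = Suc k"
    then have fin: "finite S" "S \<noteq> {}"
      using finite_V by (auto intro: finite_subset)
    have "transp_on S (\<lambda>x y. (x, y) \<in> E)"
      using assms by (auto intro!: transp_onI dest: transD)
    moreover have "totalp_on S (\<lambda>x y. (x, y) \<in> E)"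
      using S arc_iff by (auto intro!: totalp_onI)
    ultimately obtain x where x: "x \<in> S" "\<forall>y\<in>S. y \<noteq> x \<longrightarrow> (x, y) \<in> E"
      using Finite_Set.bex_least_element[OF fin] by blast
    then have "(x, S - {x}) \<in> (SIGMA x:V. {S. S \<subseteq> E `` {x} \<and> card S = k})"
      using S fin by auto
    moreover have "S = (\<lambda>(x, S). insert x S) (x, S - {x})"
      using x by auto
    ultimately show "S \<in> (\<lambda>(x, S). insert x S) ` (SIGMA x:V. {S. S \<subseteq> E `` {x} \<and> card S = k})"
      by (rule rev_image_eqI)
  qed
  then have "(\<lambda>(x, S). insert x S) ` (SIGMA x:V. {S. S \<subseteq> E `` {x} \<and> card S = k}) =
      {S. S \<subseteq> V \<and> card S = Suc k}"
    by (rule subset_antisym[OF sourced_subsets])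
  then show ?thesis
    by (simp only: sum_score_choose n_subsets[OF finite_V])
qed

section \<open>Sums of squares and cubes of scores\<close>

lemma sum_score_square_eq:
  "(\<Sum>x\<in>V. score x ^ 2) = 2 * (\<Sum>x\<in>V. score x choose 2) + (\<Sum>x\<in>V. score x choose 1)"
  by (simp only: square_eq_binomials sum.distrib sum_distrib_left)

lemma sum_score_cube_eq:
  "(\<Sum>x\<in>V. score x ^ 3) =
    6 * (\<Sum>x\<in>V. score x choose 3) + 6 * (\<Sum>x\<in>V. score x choose 2) + (\<Sum>x\<in>V. score x choose 1)"
  by (simp only: cube_eq_binomials sum.distrib sum_distrib_left)

lemma sum_score_square_le: "(\<Sum>x\<in>V. score x ^ 2) \<le> 2 * (card V choose 3) + (card V choose 2)"
  using sum_score_choose_le[of 1] sum_score_choose_le[of 2]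
  unfolding sum_score_square_eq by (simp add: eval_nat_numeral)

lemma sum_score_cube_le:
  "(\<Sum>x\<in>V. score x ^ 3) \<le> 6 * (card V choose 4) + 6 * (card V choose 3) + (card V choose 2)"
  using sum_score_choose_le[of 1] sum_score_choose_le[of 2] sum_score_choose_le[of 3]
  unfolding sum_score_cube_eq by (simp add: eval_nat_numeral)

lemma sum_score_square_trans:
  assumes "trans E"
  shows "(\<Sum>x\<in>V. score x ^ 2) = 2 * (card V choose 3) + (card V choose 2)"
  unfolding sum_score_square_eq sum_score_choose_trans[OF assms] by (simp add: eval_nat_numeral)

lemma sum_score_cube_trans:
  assumes "trans E"
  shows "(\<Sum>x\<in>V. score x ^ 3) = 6 * (card V choose 4) + 6 * (card V choose 3) + (card V choose 2)"
  unfolding sum_score_cube_eq sum_score_choose_trans[OF assms] by (simp add: eval_nat_numeral)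

section \<open>Closed walks of length 3\<close>

lemma cyclic_triples_trans: "trans E \<Longrightarrow> cyclic_triples = 0"
  unfolding cyclic_triples_def using asym_E by (auto intro!: sum.neutral dest: transD)

text \<open>Forgetting the closing arc leaves the walks x -> y -> z; grouped by their midpoint they
  number in-degree times out-degree.\<close>

lemma cyclic_triples_le: "cyclic_triples \<le> (\<Sum>y\<in>V. score y * (card V - 1 - score y))"
proof -
  have "cyclic_triples \<le> (\<Sum>x\<in>V. \<Sum>y\<in>V. \<Sum>z\<in>V. of_bool ((x, y) \<in> E) * of_bool ((y, z) \<in> E))"
    unfolding cyclic_triples_def by (intro sum_mono) auto
  also have "\<dots> = (\<Sum>x\<in>V. \<Sum>y\<in>V. of_bool ((x, y) \<in> E) * score y)"
    by (simp only: score_eq_sum sum_distrib_left)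
  also have "\<dots> = (\<Sum>y\<in>V. (\<Sum>x\<in>V. of_bool ((x, y) \<in> E)) * score y)"
    by (subst sum.swap) (simp only: sum_distrib_right)
  also have "\<dots> = (\<Sum>y\<in>V. score y * (card V - 1 - score y))"
  proof (intro sum.cong refl)
    fix y assume "y \<in> V"
    then have "(\<Sum>x\<in>V. of_bool ((x, y) \<in> E)) = card V - 1 - score y"
      using in_degree_plus_score[of y] by simp
    then show "(\<Sum>x\<in>V. of_bool ((x, y) \<in> E)) * score y = score y * (card V - 1 - score y)"
      by simp
  qed
  finally show ?thesis .
qed

lemma cyclic_triples_le_sum_cube: "cyclic_triples \<le> (\<Sum>x\<in>V. score x ^ 3)"
proof -
  have le: "score x \<le> card V - 1" if "x \<in> V" for x
    using in_degree_plus_score[OF that] by simp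
  have "(\<Sum>x\<in>V. score x * (card V - 1 - score x)) \<le> (\<Sum>x\<in>V. score x ^ 3)"
  proof (cases "card V \<ge> 3")
    case False
    \<comment> \<open>With at most two vertices the left side vanishes. The tangent argument below
      would fail for two vertices, where the mean score is 1/2.\<close>
    have "score x * (card V - 1 - score x) \<le> score x ^ 3" if "x \<in> V" for x
      using le[OF that] False by (cases "score x") auto
    then show ?thesis by (rule sum_mono)
  next
    case True
    define m where "m = (real (card V) - 1) / 2"
    have m: "m \<ge> 1" using True by (simp add: m_def)
    have "real (\<Sum>x\<in>V. score x) = card V * m"
      using arg_cong[OF sum_score, of real] True by (simp add: m_def of_nat_diff)
    \<comment> \<open>the tangent line of \<open>x ^ 3 - x * (2 * m - x)\<close> at the mean score \<open>m\<close>\<close>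
    then have "0 = 3 * m ^ 2 * (\<Sum>x\<in>V. real (score x) - m)"
      by (simp add: sum_subtractf)
    \<comment> \<open>The value \<open>m ^ 3 - m ^ 2\<close> at the mean is nonnegative since
      \<open>m\<close> is at least 1.\<close>
    also have "\<dots> \<le> (\<Sum>x\<in>V. 3 * m ^ 2 * (real (score x) - m) + (m ^ 3 - m ^ 2))"
      using m power_increasing[of 2 3 m] by (simp add: sum.distrib sum_distrib_left)
    also have "\<dots> \<le> (\<Sum>x\<in>V. real (score x) ^ 3 - real (score x) * (2 * m - real (score x)))"
    proof (rule sum_mono)
      fix x
      \<comment> \<open>This product is the cubic minus its tangent at \<open>m\<close>: a double
        root at \<open>m\<close> and a linear factor that is positive on scores.\<close>
      have "0 \<le> (real (score x) - m) ^ 2 * (real (score x) + 2 * m + 1)"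
        using m by simp
      also have "\<dots> = real (score x) ^ 3 - real (score x) * (2 * m - real (score x))
          - (3 * m ^ 2 * (real (score x) - m) + (m ^ 3 - m ^ 2))"
        by (simp add: power2_eq_square power3_eq_cube algebra_simps)
      finally show "3 * m ^ 2 * (real (score x) - m) + (m ^ 3 - m ^ 2)
          \<le> real (score x) ^ 3 - real (score x) * (2 * m - real (score x))" by simp
    qed
    also have "\<dots> = real (\<Sum>x\<in>V. score x ^ 3)
        - real (\<Sum>x\<in>V. score x * (card V - 1 - score x))"
    proof -
      have "real (card V - 1 - score x) = 2 * m - real (score x)" if "x \<in> V" for x
        using le[OF that] True by (simp add: m_def of_nat_diff field_simps)
      then show ?thesis
        by (simp add: sum_subtractf)
    qed
    finally show ?thesis by linarith
  qed
  then show ?thesis using cyclic_triples_le by linarith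
qed

section \<open>Traces of powers of the Laplacian\<close>

text \<open>Indexing by vertices and leaving out the scaling keeps the computation free of any
  enumeration; \<open>ex_enumeration_laplacian\<close> makes the link to the matrix.\<close>

definition laplacian :: "'a \<Rightarrow> 'a \<Rightarrow> complex" where
  "laplacian x y = (if x = y then of_nat (score x) else 0) - (if (x, y) \<in> E then 1 else 0)"

lemma sum_laplacian_2:
  "(\<Sum>x\<in>V. \<Sum>y\<in>V. laplacian x y * laplacian y x) = of_nat (\<Sum>x\<in>V. score x ^ 2)"
proof -
  have "laplacian x y * laplacian y x = (if x = y then of_nat (score x ^ 2) else 0)" for x y
    using asym_E irrefl_E by (auto simp: laplacian_def power2_eq_square)
  then show ?thesis using finite_V by simp
qed

lemma sum_laplacian_3:
  "(\<Sum>x\<in>V. \<Sum>y\<in>V. \<Sum>z\<in>V. laplacian x y * laplacian y z * laplacian z x) =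
    of_nat (\<Sum>x\<in>V. score x ^ 3) - of_nat cyclic_triples"
proof -
  \<comment> \<open>If exactly two of the vertices coincide, the product contains both orientations
    of one pair and vanishes. Three distinct vertices give three factors -1 around a directed
    triangle, hence the minus sign. The nested conditionals let the sums over \<open>z\<close> and
    \<open>y\<close> collapse.\<close>
  have *: "laplacian x y * laplacian y z * laplacian z x =
      (if z = y then if x = y then of_nat (score x ^ 3) else 0 else 0) -
      of_bool ((x, y) \<in> E) * of_bool ((y, z) \<in> E) * of_bool ((z, x) \<in> E)" for x y z
    using asym_E irrefl_E by (auto simp: laplacian_def power3_eq_cube)
  show ?thesis
    unfolding * using finite_V
    by (simp add: sum_subtractf cyclic_triples_def)
qed

end

section \<open>Entropy of tournaments\<close>

lemma tournament_arcs_tournament: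
  assumes "tournament n T"
  shows "tournament_arcs (pverts T) (parcs T)"
proof -
  interpret pair_digraph T
    using assms by (simp add: tournament_def)
  show ?thesis
  proof
    show "finite (pverts T)" by (rule pair_finite_verts)
    show "parcs T \<subseteq> pverts T \<times> pverts T" by (auto dest: in_arcsD1 in_arcsD2)
    show "(x, x) \<notin> parcs T" for x using pair_no_loops[of "(x, x)"] by auto
    show "(x, y) \<in> parcs T \<longleftrightarrow> (y, x) \<notin> parcs T"
      if "x \<in> pverts T" "y \<in> pverts T" "x \<noteq> y" for x y
      using assms that unfolding tournament_def by blast
  qed
qed

lemma spectral_power_sum_eq_trace:
  assumes "vertex_enumeration T v"
  shows "spectral_power_sum k T = mat_trace (normalized_laplacian T v ^\<^sub>m k)"
  unfolding spectral_power_sum_def laplacian_spectrum_eq[OF assms]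
  by (rule sum_proots_char_poly_pow[OF normalized_laplacian_carrier])

context
  fixes n :: nat and T :: "'a pair_pre_digraph"
  assumes T: "tournament n T"
begin

interpretation tournament_arcs "pverts T" "parcs T"
  by (rule tournament_arcs_tournament[OF T])

lemma card_pverts: "card (pverts T) = n"
  using T by (simp add: tournament_def)

lemma ex_enumeration_laplacian:
  obtains v where "vertex_enumeration T v"
    "bij_betw v {0..<n} (pverts T)"
    "\<And>i j. i < n \<Longrightarrow> j < n \<Longrightarrow>
      normalized_laplacian T v $$ (i, j) = inverse (of_nat (n choose 2)) * laplacian (v i) (v j)"
proof -
  obtain v where v: "vertex_enumeration T v"
    using ex_vertex_enumeration[OF finite_V] by blast
  then have bij: "bij_betw v {0..<n} (pverts T)"
    by (simp add: vertex_enumeration_def card_pverts)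
  \<comment> \<open>\<open>out_degree\<close> counts arcs while \<open>score\<close> counts their
    heads.\<close>
  have "out_arcs (with_proj T) x = Pair x ` (parcs T `` {x})" for x
    by (auto simp: out_arcs_def)
  then have "out_degree (with_proj T) x = score x" for x
    by (simp add: out_degree_def score_def card_image inj_on_def)
  moreover have "v i = v j \<longleftrightarrow> i = j" if "i < n" "j < n" for i j
    using bij that by (auto simp: bij_betw_def inj_on_def)
  ultimately show ?thesis
    by (intro that[OF v bij]) (simp add: normalized_laplacian_index card_pverts laplacian_def)
qed

lemma spectral_power_sum_2:
  "spectral_power_sum 2 T =
    of_real (inverse (real (n choose 2)) ^ 2 * real (\<Sum>x\<in>pverts T. score x ^ 2))"
proof -
  define c :: complex where "c = inverse (of_nat (n choose 2))"
  obtain v where v: "vertex_enumeration T v" and bij: "bij_betw v {0..<n} (pverts T)"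
    and L: "\<And>i j. i < n \<Longrightarrow> j < n \<Longrightarrow>
      normalized_laplacian T v $$ (i, j) = c * laplacian (v i) (v j)"
    unfolding c_def using ex_enumeration_laplacian by blast
  have carrier: "normalized_laplacian T v \<in> carrier_mat n n"
    using normalized_laplacian_carrier[of T v] by (simp only: card_pverts)
  have "spectral_power_sum 2 T =
      c ^ 2 * (\<Sum>i = 0..<n. \<Sum>j = 0..<n. laplacian (v i) (v j) * laplacian (v j) (v i))"
    by (simp add: spectral_power_sum_eq_trace[OF v] mat_trace_pow_2[OF carrier] L
        sum_distrib_left power2_eq_square mult_ac)
  also have "\<dots> = c ^ 2 * (\<Sum>x\<in>pverts T. \<Sum>y\<in>pverts T. laplacian x y * laplacian y x)"
    by (simp only: sum.reindex_bij_betw[OF bij, symmetric])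
  finally show ?thesis
    by (simp add: sum_laplacian_2 c_def)
qed

lemma spectral_power_sum_3:
  "spectral_power_sum 3 T =
    of_real (inverse (real (n choose 2)) ^ 3 *
      (real (\<Sum>x\<in>pverts T. score x ^ 3) - real cyclic_triples))"
proof -
  define c :: complex where "c = inverse (of_nat (n choose 2))"
  obtain v where v: "vertex_enumeration T v" and bij: "bij_betw v {0..<n} (pverts T)"
    and L: "\<And>i j. i < n \<Longrightarrow> j < n \<Longrightarrow>
      normalized_laplacian T v $$ (i, j) = c * laplacian (v i) (v j)"
    unfolding c_def using ex_enumeration_laplacian by blast
  have carrier: "normalized_laplacian T v \<in> carrier_mat n n"
    using normalized_laplacian_carrier[of T v] by (simp only: card_pverts)
  have "spectral_power_sum 3 T =
      c ^ 3 * (\<Sum>i = 0..<n. \<Sum>j = 0..<n. \<Sum>k = 0..<n.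
        laplacian (v i) (v j) * laplacian (v j) (v k) * laplacian (v k) (v i))"
    by (simp add: spectral_power_sum_eq_trace[OF v] mat_trace_pow_3[OF carrier] L
        sum_distrib_left power3_eq_cube mult_ac)
  also have "\<dots> = c ^ 3 * (\<Sum>x\<in>pverts T. \<Sum>y\<in>pverts T. \<Sum>z\<in>pverts T.
      laplacian x y * laplacian y z * laplacian z x)"
    by (simp only: sum.reindex_bij_betw[OF bij, symmetric])
  finally show ?thesis
    by (simp add: sum_laplacian_3 c_def)
qed

lemma spectral_power_sum_nonneg:
  "0 \<le> Re (spectral_power_sum 2 T)" "0 \<le> Re (spectral_power_sum 3 T)"
  using cyclic_triples_le_sum_cube
  by (simp_all only: spectral_power_sum_2 spectral_power_sum_3 Re_complex_of_real)
    (auto simp flip: of_nat_power of_nat_sum intro!: mult_nonneg_nonneg)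

lemma spectral_power_sum_2_le:
  "Re (spectral_power_sum 2 T) \<le>
    inverse (real (n choose 2)) ^ 2 * real (2 * (n choose 3) + (n choose 2))"
  unfolding spectral_power_sum_2 Re_complex_of_real
  using sum_score_square_le
  by (intro mult_left_mono) (simp_all only: of_nat_le_iff card_pverts, simp)

lemma spectral_power_sum_3_le:
  "Re (spectral_power_sum 3 T) \<le>
    inverse (real (n choose 2)) ^ 3 * real (6 * (n choose 4) + 6 * (n choose 3) + (n choose 2))"
proof -
  have "real (\<Sum>x\<in>pverts T. score x ^ 3) - real cyclic_triples \<le>
      real (6 * (n choose 4) + 6 * (n choose 3) + (n choose 2))"
    using sum_score_cube_le[unfolded card_pverts] by linarith
  then show ?thesis
    unfolding spectral_power_sum_3 Re_complex_of_real
    by (intro mult_left_mono) auto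
qed

lemma spectral_power_sum_2_trans:
  assumes "trans (parcs T)"
  shows "Re (spectral_power_sum 2 T) =
    inverse (real (n choose 2)) ^ 2 * real (2 * (n choose 3) + (n choose 2))"
  by (simp only: spectral_power_sum_2 Re_complex_of_real sum_score_square_trans[OF assms] card_pverts)

lemma spectral_power_sum_3_trans:
  assumes "trans (parcs T)"
  shows "Re (spectral_power_sum 3 T) =
    inverse (real (n choose 2)) ^ 3 * real (6 * (n choose 4) + 6 * (n choose 3) + (n choose 2))"
  by (simp only: spectral_power_sum_3 Re_complex_of_real sum_score_cube_trans[OF assms]
      cyclic_triples_trans[OF assms] card_pverts of_nat_0 diff_zero)

end

text \<open>The factor 1/(1 - \<alpha>) is negative, so a larger power sum means a smaller entropy;
  a vanishing power sum of \<open>T\<close> gives infinite entropy. Nonnegativity keeps the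
  logarithm on positive arguments, where it is monotone.\<close>

lemma renyi_entropy_antimono:
  assumes "\<alpha> \<ge> 2" and nonneg: "0 \<le> Re (spectral_power_sum \<alpha> T)"
    and le: "Re (spectral_power_sum \<alpha> T) \<le> Re (spectral_power_sum \<alpha> T\<^sub>0)"
  shows "renyi_entropy \<alpha> T\<^sub>0 \<le> renyi_entropy \<alpha> T"
proof (cases "spectral_power_sum \<alpha> T = 0")
  case True
  then show ?thesis by (simp add: renyi_entropy_def)
next
  case False
  \<comment> \<open>The power sum is real, so it is nonzero only if its real part is.\<close>
  have "Re (spectral_power_sum \<alpha> T) \<noteq> 0"
    using False spectral_power_sum_real[of \<alpha> T] by (auto simp: complex_eq_iff complex_is_Real_iff)
  then have pos: "0 < Re (spectral_power_sum \<alpha> T)" using nonneg by simp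
  then have "spectral_power_sum \<alpha> T\<^sub>0 \<noteq> 0" using le by auto
  moreover have "log 2 (Re (spectral_power_sum \<alpha> T)) \<le> log 2 (Re (spectral_power_sum \<alpha> T\<^sub>0))"
    using pos le by simp
  then have "1 / (1 - real \<alpha>) * log 2 (Re (spectral_power_sum \<alpha> T\<^sub>0)) \<le>
      1 / (1 - real \<alpha>) * log 2 (Re (spectral_power_sum \<alpha> T))"
    using \<open>\<alpha> \<ge> 2\<close> by (intro mult_left_mono_neg) auto
  ultimately show ?thesis
    using False by (simp add: renyi_entropy_def)
qed

theorem theorem2:
  fixes n :: nat
    and T\<^sub>0 :: "'a pair_pre_digraph"
    and T :: "'b pair_pre_digraph"
  assumes "n \<ge> 2"
    and "transitive_tournament n T\<^sub>0"
    and "tournament n T"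
  shows "renyi_entropy 2 T\<^sub>0 \<le> renyi_entropy 2 T \<and> renyi_entropy 3 T\<^sub>0 \<le> renyi_entropy 3 T"
proof -
  have T0: "tournament n T\<^sub>0" "trans (parcs T\<^sub>0)"
    using assms by (auto simp: transitive_tournament_def)
  show ?thesis
    \<comment> \<open>The upper bounds for \<open>T\<close> are the exact values for the transitive
      tournament, which the simplifier substitutes.\<close>
    using spectral_power_sum_nonneg[OF assms(3)] spectral_power_sum_2_le[OF assms(3)]
      spectral_power_sum_3_le[OF assms(3)]
    by (auto intro!: renyi_entropy_antimono
        simp only: spectral_power_sum_2_trans[OF T0] spectral_power_sum_3_trans[OF T0])
qed

end
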